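(* Choose any $\beta,\gamma\in(0,1)$. There is a finite semimetric space $(X,d)$, with $n=|X|=2^{\mathrm{dens}(X)}$ arbitrarily large, and a distribution of $(\beta,\gamma)$-convex $2$-clusterings $\mathcal C$ of $X$ (for either notion of $(\beta,\gamma)$-convexity, the uniform-radius one or the generalized one) such that any algorithm (even randomized) needs $\Omega(2^{\mathrm{dens}(X)})$ same-cluster and/or SEED queries to recover $\mathcal C$ with constant probability. This holds even if $\beta,\gamma$ and the radius $\epsilon$ are known to the algorithm.
   Context: Semimetric: $X$ is a finite set and $d$ is symmetric with $d(x,x)=0$ and $d(x,y)\in(0,\infty]$ for $x\neq y$ (the triangle inequality is not required). The algorithm knows $(X,d)$ and accesses the unknown clustering only through queries. For $\epsilon>0$, $G_X(\epsilon)$ is the unweighted undirected graph on $X$ in which distinct $x,y$ are adjacent iff $d(x,y)\le\epsilon$. For a graph $G$, $d_G$ is the shortest-path distance (number of edges; $\infty$ if there is no path). The length of a path is its number of edges. Density dimension: $B(x,r)=\{y\in X: d(x,y)\le r\}$; for $K\subseteq X$, $\mathcal M(K,r)$ is the maximum size of a subset $A\subseteq K$ with $d(x,y)>r$ for all distinct $x,y\in A$; $\mu(X)$ is the least $\mu\in\mathbb N$ such that $\mathcal M(B(x,r),r/2)\le\mu$ for all $x\in X$, $r>0$; $\mathrm{dens}(X)=\log_2\mu(X)$. A $k$-clustering of $X$ is a partition $(C_1,\ldots,C_k)$ of $X$. Uniform-radius $(\beta,\gamma)$-convexity: there is $\epsilon>0$ such that for each $i$: (1) the subgraph of $G_X(\epsilon)$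 induced by $C_i$ is connected; (2) $d(x,y)>\beta\epsilon$ for all $x\in C_i$, $y\in X\setminus C_i$; (3) if $x,y\in C_i$, every simple path in $G_X(\epsilon)$ between $x$ and $y$ of length at most $(1+\gamma)d_{G_X(\epsilon)}(x,y)$ lies entirely in $C_i$. The smallest such $\epsilon$ is the radius. Generalized $(\beta,\gamma)$-convexity: for each $i$ there is $\epsilon_i>0$ such that: (1) the subgraph of $G_X(\epsilon_i)$ induced by $C_i$ is connected; (2) $d(x,y)>\beta\epsilon_i$ for all $x\in C_i$, $y\in X\setminus C_i$; (3) for every $\epsilon\le\epsilon_i$, if $x,y\in C_i$ and $d_{G_X(\epsilon)}(x,y)<\infty$, every simple path in $G_X(\epsilon)$ between $x$ and $y$ of length at most $(1+\gamma)d_{G_X(\epsilon)}(x,y)$ lies entirely in $C_i$. Oracles: a same-cluster query takes $x,y\in X$ and returns $1$ if they are in the same cluster of $\mathcal C$ and $0$ otherwise. A query SEED$(S,i)$, $S\subseteq X$, $i\in[k]$, returns an arbitrary point of $C_i\cap S$ (the oracle may choose which), or NIL if $C_i\cap S=\emptyset$. *)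

theory Defs
  imports
    "HOL-Probability.Probability_Mass_Function"
    "HOL-Library.Disjoint_Sets"
    "Graph_Theory.Digraph_Component"
    "Graph_Theory.Vertex_Walk"
    "Graph_Theory.Shortest_Path"
begin

section \<open>Finite semimetrics and density dimension\<close>

definition finite_semimetric :: "'a set \<Rightarrow> ('a \<Rightarrow> 'a \<Rightarrow> ereal) \<Rightarrow> bool" where
  "finite_semimetric X d \<longleftrightarrow> finite X \<and>
     (\<forall>x\<in>X. d x x = 0) \<and>
     (\<forall>x\<in>X. \<forall>y\<in>X. d x y = d y x) \<and>
     (\<forall>x\<in>X. \<forall>y\<in>X. x \<noteq> y \<longrightarrow> 0 < d x y)"

definition sm_ball :: "'a set \<Rightarrow> ('a \<Rightarrow> 'a \<Rightarrow> ereal) \<Rightarrow> 'a \<Rightarrow> real \<Rightarrow> 'a set" where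
  "sm_ball X d x r = {y\<in>X. d x y \<le> ereal r}"

definition packing_number :: "('a \<Rightarrow> 'a \<Rightarrow> ereal) \<Rightarrow> 'a set \<Rightarrow> real \<Rightarrow> nat" where
  "packing_number d K r =
     Max (card ` {A. A \<subseteq> K \<and> (\<forall>x\<in>A. \<forall>y\<in>A. x \<noteq> y \<longrightarrow> ereal r < d x y)})"

definition density_constant :: "'a set \<Rightarrow> ('a \<Rightarrow> 'a \<Rightarrow> ereal) \<Rightarrow> nat" where
  "density_constant X d =
     (LEAST \<mu>. \<forall>x\<in>X. \<forall>r>0. packing_number d (sm_ball X d x r) (r / 2) \<le> \<mu>)"

definition dens :: "'a set \<Rightarrow> ('a \<Rightarrow> 'a \<Rightarrow> ereal) \<Rightarrow> real" where
  "dens X d = log 2 (real (density_constant X d))"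

section \<open>Threshold graphs and convex clusterings\<close>

text \<open>An undirected graph is encoded as a symmetric loop-free digraph, one arc per direction.\<close>

definition threshold_graph :: "'a set \<Rightarrow> ('a \<Rightarrow> 'a \<Rightarrow> ereal) \<Rightarrow> real \<Rightarrow> 'a pair_pre_digraph" where
  "threshold_graph X d \<epsilon> =
     \<lparr> pverts = X, parcs = {(x, y). x \<in> X \<and> y \<in> X \<and> x \<noteq> y \<and> d x y \<le> ereal \<epsilon>} \<rparr>"

definition graph_dist :: "'a pair_pre_digraph \<Rightarrow> 'a \<Rightarrow> 'a \<Rightarrow> ereal" where
  "graph_dist G x y = wf_digraph.\<mu> (with_proj G) (\<lambda>_. 1) x y"

definition near_geodesics_inside ::
  "real \<Rightarrow> 'a pair_pre_digraph \<Rightarrow> 'a set \<Rightarrow> 'a \<Rightarrow> 'a \<Rightarrow> bool" where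
  "near_geodesics_inside \<gamma> G C x y \<longleftrightarrow>
     (\<forall>p. vpath p (with_proj G) \<and> hd p = x \<and> last p = y \<and>
          ereal (real (vwalk_length p)) \<le> ereal (1 + \<gamma>) * graph_dist G x y
          \<longrightarrow> set p \<subseteq> C)"

definition cluster_connected ::
  "'a set \<Rightarrow> ('a \<Rightarrow> 'a \<Rightarrow> ereal) \<Rightarrow> 'a set \<Rightarrow> real \<Rightarrow> bool" where
  "cluster_connected X d C \<epsilon> \<longleftrightarrow>
     Digraph_Component.connected (induce_subgraph (with_proj (threshold_graph X d \<epsilon>)) C)"

definition cluster_separated ::
  "'a set \<Rightarrow> ('a \<Rightarrow> 'a \<Rightarrow> ereal) \<Rightarrow> real \<Rightarrow> 'a set \<Rightarrow> real \<Rightarrow> bool" where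
  "cluster_separated X d \<beta> C \<epsilon> \<longleftrightarrow> (\<forall>x\<in>C. \<forall>y\<in>X - C. ereal (\<beta> * \<epsilon>) < d x y)"

definition clustering :: "'a set \<Rightarrow> nat \<Rightarrow> 'a set list \<Rightarrow> bool" where
  "clustering X k \<C> \<longleftrightarrow> length \<C> = k \<and> distinct \<C> \<and> partition_on X (set \<C>)"

definition uniform_convex_at ::
  "'a set \<Rightarrow> ('a \<Rightarrow> 'a \<Rightarrow> ereal) \<Rightarrow> real \<Rightarrow> real \<Rightarrow> 'a set list \<Rightarrow> real \<Rightarrow> bool" where
  "uniform_convex_at X d \<beta> \<gamma> \<C> \<epsilon> \<longleftrightarrow> 0 < \<epsilon> \<and>
     (\<forall>C\<in>set \<C>.
        cluster_connected X d C \<epsilon> \<and>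
        cluster_separated X d \<beta> C \<epsilon> \<and>
        (\<forall>x\<in>C. \<forall>y\<in>C. near_geodesics_inside \<gamma> (threshold_graph X d \<epsilon>) C x y))"

definition uniform_convex ::
  "'a set \<Rightarrow> ('a \<Rightarrow> 'a \<Rightarrow> ereal) \<Rightarrow> real \<Rightarrow> real \<Rightarrow> 'a set list \<Rightarrow> bool" where
  "uniform_convex X d \<beta> \<gamma> \<C> \<longleftrightarrow> (\<exists>\<epsilon>. uniform_convex_at X d \<beta> \<gamma> \<C> \<epsilon>)"

definition uniform_radius ::
  "'a set \<Rightarrow> ('a \<Rightarrow> 'a \<Rightarrow> ereal) \<Rightarrow> real \<Rightarrow> real \<Rightarrow> 'a set list \<Rightarrow> real \<Rightarrow> bool" where
  "uniform_radius X d \<beta> \<gamma> \<C> \<epsilon> \<longleftrightarrow> uniform_convex_at X d \<beta> \<gamma> \<C> \<epsilon> \<and>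
     (\<forall>\<epsilon>'. uniform_convex_at X d \<beta> \<gamma> \<C> \<epsilon>' \<longrightarrow> \<epsilon> \<le> \<epsilon>')"

definition generalized_convex_at ::
  "'a set \<Rightarrow> ('a \<Rightarrow> 'a \<Rightarrow> ereal) \<Rightarrow> real \<Rightarrow> real \<Rightarrow> 'a set \<Rightarrow> real \<Rightarrow> bool" where
  "generalized_convex_at X d \<beta> \<gamma> C \<epsilon> \<longleftrightarrow> 0 < \<epsilon> \<and>
     cluster_connected X d C \<epsilon> \<and>
     cluster_separated X d \<beta> C \<epsilon> \<and>
     (\<forall>\<delta>. 0 < \<delta> \<and> \<delta> \<le> \<epsilon> \<longrightarrow>
        (\<forall>x\<in>C. \<forall>y\<in>C. graph_dist (threshold_graph X d \<delta>) x y < \<infinity> \<longrightarrow>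
           near_geodesics_inside \<gamma> (threshold_graph X d \<delta>) C x y))"

definition generalized_convex ::
  "'a set \<Rightarrow> ('a \<Rightarrow> 'a \<Rightarrow> ereal) \<Rightarrow> real \<Rightarrow> real \<Rightarrow> 'a set list \<Rightarrow> bool" where
  "generalized_convex X d \<beta> \<gamma> \<C> \<longleftrightarrow>
     (\<forall>C\<in>set \<C>. \<exists>\<epsilon>. generalized_convex_at X d \<beta> \<gamma> C \<epsilon>)"

definition generalized_radius ::
  "'a set \<Rightarrow> ('a \<Rightarrow> 'a \<Rightarrow> ereal) \<Rightarrow> real \<Rightarrow> real \<Rightarrow> 'a set \<Rightarrow> real \<Rightarrow> bool" where
  "generalized_radius X d \<beta> \<gamma> C \<epsilon> \<longleftrightarrow> generalized_convex_at X d \<beta> \<gamma> C \<epsilon> \<and>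
     (\<forall>\<epsilon>'. generalized_convex_at X d \<beta> \<gamma> C \<epsilon>' \<longrightarrow> \<epsilon> \<le> \<epsilon>')"

section \<open>Query algorithms\<close>

text \<open>
  A deterministic adaptive algorithm is a decision tree: it outputs a set of clusters, or asks a
  query and continues according to the answer. A randomized algorithm is a probability distribution
  over such trees. Clusters are indexed from 0.
\<close>

datatype 'a query_alg =
    Output "'a set set"
  | Same_Query 'a 'a "bool \<Rightarrow> 'a query_alg"
  | Seed_Query "'a set" nat "'a option \<Rightarrow> 'a query_alg"

primrec legal_alg :: "'a set \<Rightarrow> nat \<Rightarrow> 'a query_alg \<Rightarrow> bool" where
  "legal_alg X k (Output P) \<longleftrightarrow> True"
| "legal_alg X k (Same_Query x y f) \<longleftrightarrow> x \<in> X \<and> y \<in> X \<and> (\<forall>b. legal_alg X k (f b))"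
| "legal_alg X k (Seed_Query S i f) \<longleftrightarrow> S \<subseteq> X \<and> i < k \<and>
     (\<forall>z. set_option z \<subseteq> S \<longrightarrow> legal_alg X k (f z))"

definition same_cluster :: "'a set list \<Rightarrow> 'a \<Rightarrow> 'a \<Rightarrow> bool" where
  "same_cluster \<C> x y \<longleftrightarrow> (\<exists>C\<in>set \<C>. x \<in> C \<and> y \<in> C)"

text \<open>
  The oracle's freedom in answering SEED is modelled by a selector that may depend on the hidden
  clustering but not on the history. Requiring an algorithm to cope only with these oracles is
  the weakest requirement, so it gives the strongest lower bound.
\<close>

type_synonym 'a seed_oracle = "'a set list \<Rightarrow> 'a set \<Rightarrow> nat \<Rightarrow> 'a option"

definition valid_seed_answer :: "'a set \<Rightarrow> 'a option \<Rightarrow> bool" where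
  "valid_seed_answer T a \<longleftrightarrow> (case a of None \<Rightarrow> T = {} | Some x \<Rightarrow> x \<in> T)"

definition valid_seed_oracle :: "'a set \<Rightarrow> 'a set list set \<Rightarrow> 'a seed_oracle \<Rightarrow> bool" where
  "valid_seed_oracle X \<S> sd \<longleftrightarrow>
     (\<forall>\<C>\<in>\<S>. \<forall>S i. S \<subseteq> X \<and> i < length \<C> \<longrightarrow> valid_seed_answer (\<C> ! i \<inter> S) (sd \<C> S i))"

primrec alg_output :: "'a seed_oracle \<Rightarrow> 'a set list \<Rightarrow> 'a query_alg \<Rightarrow> 'a set set" where
  "alg_output sd \<C> (Output P) = P"
| "alg_output sd \<C> (Same_Query x y f) = alg_output sd \<C> (f (same_cluster \<C> x y))"
| "alg_output sd \<C> (Seed_Query S i f) = alg_output sd \<C> (f (sd \<C> S i))"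

primrec alg_queries :: "'a seed_oracle \<Rightarrow> 'a set list \<Rightarrow> 'a query_alg \<Rightarrow> nat" where
  "alg_queries sd \<C> (Output P) = 0"
| "alg_queries sd \<C> (Same_Query x y f) = Suc (alg_queries sd \<C> (f (same_cluster \<C> x y)))"
| "alg_queries sd \<C> (Seed_Query S i f) = Suc (alg_queries sd \<C> (f (sd \<C> S i)))"

text \<open>
  Recovery means recovering the clusters; their numbering need not be returned. The hidden
  clustering is independent of the algorithm's random choices.
\<close>

definition recovers_with_prob ::
  "'a set \<Rightarrow> 'a set list pmf \<Rightarrow> 'a query_alg pmf \<Rightarrow> nat \<Rightarrow> real \<Rightarrow> bool" where
  "recovers_with_prob X D R q p \<longleftrightarrow>
     (\<forall>sd. valid_seed_oracle X (set_pmf D) sd \<longrightarrow>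
        p \<le> measure_pmf.prob (pair_pmf D R)
              {(\<C>, A). alg_output sd \<C> A = set \<C> \<and> alg_queries sd \<C> A \<le> q})"

end

theory Submission
  imports Defs
begin

text \<open>
  If all distinct points are at distance 1 then the threshold graph is either edgeless or complete,
  so every 2-clustering without singletons is convex for both notions, with radius 1. Hide a
  uniformly random subset \<open>S\<close> as the first cluster, subject only to fixing two points on each side.
  Let SEED answer with the least point of the requested cluster. Such an answer reveals the
  membership of \<open>j\<close> unknown points with probability about \<open>2\<close> to the power \<open>- j\<close>, so it carries
  boundedly many bits although it has many possible values. Quantitatively, weigh a state of
  knowledge with \<open>u\<close> undetermined points by \<open>(4/3) ^ u\<close>. A query increases the total weight of the
  possible states by a factor of at most 3, so at most \<open>3 ^ q * (4/3) ^ u\<close> of the \<open>2 ^ u\<close> subsets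
  are recovered within \<open>q\<close> queries.
\<close>

section \<open>The discrete metric\<close>

definition discrete_dist :: "'a \<Rightarrow> 'a \<Rightarrow> ereal" where
  "discrete_dist x y = (if x = y then 0 else 1)"

lemma finite_semimetric_discrete: "finite X \<Longrightarrow> finite_semimetric X discrete_dist"
  by (auto simp: finite_semimetric_def discrete_dist_def)

text \<open>Every packing is a subset of \<open>X\<close>, which bounds the constant from above. The
  bound is attained at radius 1: that ball is all of \<open>X\<close>, and \<open>X\<close> itself
  is 1/2-separated.\<close>

lemma density_constant_discrete:
  assumes "finite X" "X \<noteq> {}"
  shows "density_constant X discrete_dist = card X"
  unfolding density_constant_def
proof (rule Least_equality, intro ballI allI impI)
  fix x :: 'a and r :: real
  define \<A> where "\<A> = {A. A \<subseteq> sm_ball X discrete_dist x r \<and>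
    (\<forall>u\<in>A. \<forall>v\<in>A. u \<noteq> v \<longrightarrow> ereal (r / 2) < discrete_dist u v)}"
  have sub: "\<A> \<subseteq> Pow X" by (auto simp: \<A>_def sm_ball_def)
  then have "finite \<A>" by (rule finite_subset) (simp add: assms(1))
  moreover have "{} \<in> \<A>" by (simp add: \<A>_def)
  moreover have "card A \<le> card X" if "A \<in> \<A>" for A
    using sub that assms(1) by (intro card_mono) auto
  ultimately show "packing_number discrete_dist (sm_ball X discrete_dist x r) (r / 2) \<le> card X"
    unfolding packing_number_def \<A>_def[symmetric] by (subst Max_le_iff) auto
next
  fix \<mu> assume \<mu>: "\<forall>x\<in>X. \<forall>r>0. packing_number discrete_dist (sm_ball X discrete_dist x r) (r / 2) \<le> \<mu>"
  obtain x where x: "x \<in> X" using assms(2) by blast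
  have ball: "sm_ball X discrete_dist x 1 = X"
    by (auto simp: sm_ball_def discrete_dist_def one_ereal_def zero_ereal_def)
  define \<A> where "\<A> = {A. A \<subseteq> X \<and>
    (\<forall>u\<in>A. \<forall>v\<in>A. u \<noteq> v \<longrightarrow> ereal (1 / 2) < discrete_dist u v)}"
  have "\<A> \<subseteq> Pow X" by (auto simp: \<A>_def)
  then have "finite \<A>" by (rule finite_subset) (simp add: assms(1))
  moreover have "X \<in> \<A>" by (simp add: \<A>_def discrete_dist_def one_ereal_def)
  ultimately have "card X \<le> packing_number discrete_dist X (1 / 2)"
    unfolding packing_number_def \<A>_def[symmetric] by (intro Max_ge) auto
  also have "\<dots> \<le> \<mu>" using \<mu>[rule_format, OF x, of 1] by (simp add: ball)
  finally show "card X \<le> \<mu>" .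
qed

section \<open>Threshold graphs and convexity for the discrete metric\<close>

lemma parcs_threshold_graph_discrete:
  "parcs (threshold_graph X discrete_dist \<delta>) =
     {(x, y). x \<in> X \<and> y \<in> X \<and> x \<noteq> y \<and> 1 \<le> \<delta>}"
  by (auto simp: threshold_graph_def discrete_dist_def one_ereal_def)

lemma pair_wf_digraph_threshold_graph: "pair_wf_digraph (threshold_graph X d \<delta>)"
  by unfold_locales (auto simp: threshold_graph_def)

lemma graph_dist_le_1:
  assumes "pair_wf_digraph G" "(x, y) \<in> parcs G"
  shows "graph_dist G x y \<le> 1"
proof -
  interpret pair_wf_digraph G by fact
  have "awalk x [(x, y)] y"
    using assms(2) by (auto simp: awalk_def dest: in_arcsD1)
  from min_cost_le_walk_cost[OF this, of "\<lambda>_. 1"] show ?thesis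
    by (simp add: graph_dist_def awalk_cost_def one_ereal_def)
qed

text \<open>A path with at least one edge forces 1 \<le> \<delta>, so the graph is complete and its
  distinct endpoints are adjacent. Since 1 + \<gamma> < 2, such a path has only one edge and visits
  nothing but its endpoints. No bound on \<delta> is imposed, so both notions of convexity are
  served.\<close>

lemma near_geodesics_inside_discrete:
  assumes "0 < \<gamma>" "\<gamma> < 1" "x \<in> C" "y \<in> C" "C \<subseteq> X"
  shows "near_geodesics_inside \<gamma> (threshold_graph X discrete_dist \<delta>) C x y"
  unfolding near_geodesics_inside_def
proof (intro allI impI, elim conjE)
  fix p
  let ?G = "threshold_graph X discrete_dist \<delta>"
  assume p: "vpath p (with_proj ?G)" "hd p = x" "last p = y"
    and len: "ereal (real (vwalk_length p)) \<le> ereal (1 + \<gamma>) * graph_dist ?G x y"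
  have ne: "p \<noteq> []" and dist: "distinct p" using p(1) by (auto simp: vpath_def vwalk_def)
  show "set p \<subseteq> C"
  proof (cases "tl p")
    case Nil
    then have "p = [x]" using ne p(2) by (cases p) auto
    then show ?thesis using assms by simp
  next
    case (Cons v r)
    then have pr: "p = x # v # r" using ne p(2) by (cases p) auto
    then have "x \<noteq> y" using dist p(3) by (metis distinct.simps(2) last_ConsR last_in_set list.distinct(1))
    moreover have "1 \<le> \<delta>"
      using p(1) pr by (auto simp: vpath_def vwalk_def parcs_threshold_graph_discrete)
    ultimately have "(x, y) \<in> parcs ?G"
      using assms by (auto simp: parcs_threshold_graph_discrete)
    then have "graph_dist ?G x y \<le> 1"
      by (rule graph_dist_le_1[OF pair_wf_digraph_threshold_graph])
    then have "ereal (1 + \<gamma>) * graph_dist ?G x y \<le> ereal (1 + \<gamma>) * 1"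
      using assms by (intro ereal_mult_left_mono) auto
    from order_trans[OF len this] have "ereal (real (vwalk_length p)) \<le> ereal (1 + \<gamma>)"
      by simp
    \<comment> \<open>The path \<open>x # v # r\<close> has \<open>length r + 1\<close>
      edges.\<close>
    then have "real (length r) \<le> \<gamma>" by (simp add: pr)
    then have "r = []" using assms(2) by (cases r) auto
    then show ?thesis using assms p(3) pr by auto
  qed
qed

text \<open>For \<delta> < 1 the induced graph is edgeless and two distinct points are disconnected;
  for \<delta> at least 1 it is complete. This alone makes the smallest admissible radius exactly
  1.\<close>

lemma cluster_connected_discrete_iff:
  assumes "x \<in> C" "y \<in> C" "x \<noteq> y" "C \<subseteq> X"
  shows "cluster_connected X discrete_dist C \<delta> \<longleftrightarrow> 1 \<le> \<delta>"
proof -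
  \<comment> \<open>\<open>connected\<close> means strong connectivity of the symmetric closure, and
    \<open>H\<close> is that closure of the induced subgraph.\<close>
  define H where "H = mk_symmetric (with_proj (threshold_graph X discrete_dist \<delta>) \<restriction> C)"
  have verts: "pverts H = C" by (simp add: H_def)
  have arcs: "parcs H = {(u, v). u \<in> C \<and> v \<in> C \<and> u \<noteq> v \<and> 1 \<le> \<delta>}"
    using assms(4)
    unfolding H_def parcs_mk_symmetric by (fastforce simp: parcs_threshold_graph_discrete)
  interpret H: pair_wf_digraph H by unfold_locales (auto simp: verts arcs)
  have "cluster_connected X discrete_dist C \<delta> \<longleftrightarrow> strongly_connected (with_proj H)"
    by (simp add: cluster_connected_def connected_def H_def)
  also have "\<dots> \<longleftrightarrow> 1 \<le> \<delta>"
  proof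
    assume "strongly_connected (with_proj H)"
    then have "x \<rightarrow>\<^sup>*\<^bsub>with_proj H\<^esub> y" using assms by (auto simp: strongly_connected_def verts)
    then have "parcs H \<noteq> {}" using assms(3)
      by (metis H.reachable_neq_reachable1 trancl_empty empty_iff with_proj_simps(3))
    then show "1 \<le> \<delta>" by (auto simp: arcs)
  next
    assume "1 \<le> \<delta>"
    then have "u \<rightarrow>\<^sup>*\<^bsub>with_proj H\<^esub> v" if "u \<in> C" "v \<in> C" for u v
      using that by (cases "u = v") (auto simp: arcs verts)
    then show "strongly_connected (with_proj H)"
      using assms by (auto simp: strongly_connected_def verts)
  qed
  finally show ?thesis .
qed

lemma cluster_separated_discrete:
  "\<beta> < 1 \<Longrightarrow> cluster_separated X discrete_dist \<beta> C 1"
  by (auto simp: cluster_separated_def discrete_dist_def one_ereal_def)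

lemma generalized_radius_discrete:
  assumes "\<beta> < 1" "0 < \<gamma>" "\<gamma> < 1" "x \<in> C" "y \<in> C" "x \<noteq> y" "C \<subseteq> X"
  shows "generalized_radius X discrete_dist \<beta> \<gamma> C 1"
proof -
  note conn = cluster_connected_discrete_iff[OF assms(4-7)]
  have "near_geodesics_inside \<gamma> (threshold_graph X discrete_dist \<delta>) C u v"
    if "u \<in> C" "v \<in> C" for \<delta> u v
    using assms that by (intro near_geodesics_inside_discrete) auto
  then show ?thesis
    unfolding generalized_radius_def generalized_convex_at_def
    by (simp add: conn cluster_separated_discrete[OF assms(1)])
qed

lemma uniform_radius_discrete:
  assumes "\<beta> < 1" "0 < \<gamma>" "\<gamma> < 1" "\<C> \<noteq> []"
    and "\<And>C. C \<in> set \<C> \<Longrightarrow> C \<subseteq> X \<and> (\<exists>x\<in>C. \<exists>y\<in>C. x \<noteq> y)"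
  shows "uniform_radius X discrete_dist \<beta> \<gamma> \<C> 1"
proof -
  have conn: "cluster_connected X discrete_dist C \<delta> \<longleftrightarrow> 1 \<le> \<delta>" if "C \<in> set \<C>" for C \<delta>
    using assms(5)[OF that] cluster_connected_discrete_iff by metis
  have "uniform_convex_at X discrete_dist \<beta> \<gamma> \<C> 1"
    using assms conn by (auto simp: uniform_convex_at_def cluster_separated_discrete
        intro!: near_geodesics_inside_discrete)
  moreover have "1 \<le> \<epsilon>" if "uniform_convex_at X discrete_dist \<beta> \<gamma> \<C> \<epsilon>" for \<epsilon>
    using that conn assms(4) by (auto simp: uniform_convex_at_def neq_Nil_conv)
  ultimately show ?thesis by (auto simp: uniform_radius_def)
qed

section \<open>Counting the recovered clusterings\<close>

text \<open>
  The interval of sets from \<open>L\<close> to \<open>U\<close> is a state of knowledge in which the points of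
  \<open>U - L\<close> are undetermined. The point \<open>a\<close> is known to lie in the set.
\<close>

definition interval_bound :: "'a \<Rightarrow> real \<Rightarrow> ('a set \<Rightarrow> bool) \<Rightarrow> bool" where
  "interval_bound a B Q \<longleftrightarrow> (\<forall>L U. finite U \<longrightarrow> a \<in> L \<longrightarrow>
     real (card {S \<in> {L..U}. Q S}) \<le> B * (4 / 3) ^ card (U - L))"

text \<open>An undetermined \<open>x\<close> splits \<open>{L..U}\<close> into
  \<open>{insert x L..U}\<close> and \<open>{L..U - {x}}\<close>. Both have one undetermined point
  fewer, hence lose a factor 4/3 in weight, which is why \<open>B1 + B2\<close> may reach
  \<open>4 / 3 * B\<close>. If \<open>x\<close> is already determined, only one answer is possible
  and the separate bounds by \<open>B\<close> suffice.\<close>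

lemma interval_bound_split:
  assumes Q1: "interval_bound a B1 (Q True)" and Q2: "interval_bound a B2 (Q False)"
    and B: "B1 \<le> B" "B2 \<le> B" "B1 + B2 \<le> 4 / 3 * B"
  shows "interval_bound a B (\<lambda>S. Q (x \<in> S) S)"
  unfolding interval_bound_def
proof (intro allI impI)
  fix L U :: "'a set" assume fin: "finite U" and a: "a \<in> L"
  let ?N = "{S \<in> {L..U}. Q (x \<in> S) S}"
  let ?w = "\<lambda>L U. (4 / 3 :: real) ^ card (U - L)"
  consider "x \<in> L" | "x \<notin> U" | "x \<notin> L" "x \<in> U" by blast
  then show "real (card ?N) \<le> B * ?w L U"
  proof cases
    case 1
    then have "?N = {S \<in> {L..U}. Q True S}" by (auto simp: subset_iff)
    then have "real (card ?N) \<le> B1 * ?w L U"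
      using Q1 fin a by (simp add: interval_bound_def)
    also have "\<dots> \<le> B * ?w L U" using B by (intro mult_right_mono) auto
    finally show ?thesis .
  next
    case 2
    then have "x \<notin> S" if "S \<subseteq> U" for S using that by blast
    then have "S \<in> {L..U} \<and> Q (x \<in> S) S \<longleftrightarrow> S \<in> {L..U} \<and> Q False S" for S
      by (cases "S \<subseteq> U") simp_all
    then have "?N = {S \<in> {L..U}. Q False S}" by blast
    then have "real (card ?N) \<le> B2 * ?w L U"
      using Q2 fin a by (simp add: interval_bound_def)
    also have "\<dots> \<le> B * ?w L U" using B by (intro mult_right_mono) auto
    finally show ?thesis .
  next
    case 3
    define j where "j = card (U - insert x L)"
    have U1: "U - L = insert x (U - insert x L)" using 3 by auto
    have j: "card (U - L) = Suc j"
      unfolding U1 j_def using fin by (subst card_insert_disjoint) auto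
    have U2: "U - {x} - L = U - insert x L" by auto
    have "S \<in> {L..U} \<and> Q (x \<in> S) S \<longleftrightarrow>
        S \<in> {insert x L..U} \<and> Q True S \<or> S \<in> {L..U - {x}} \<and> Q False S" for S
      by (cases "x \<in> S") (auto simp: subset_Diff_insert)
    then have "?N = {S \<in> {insert x L..U}. Q True S} \<union> {S \<in> {L..U - {x}}. Q False S}"
      by blast
    then have "card ?N \<le> card {S \<in> {insert x L..U}. Q True S} + card {S \<in> {L..U - {x}}. Q False S}"
      by (simp add: card_Un_le)
    then have "real (card ?N) \<le>
        real (card {S \<in> {insert x L..U}. Q True S}) + real (card {S \<in> {L..U - {x}}. Q False S})"
      by linarith
    also have "\<dots> \<le> B1 * (4 / 3) ^ j + B2 * (4 / 3) ^ j"
      using Q1[unfolded interval_bound_def, rule_format, of U "insert x L"]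
        Q2[unfolded interval_bound_def, rule_format, of "U - {x}" L] fin a
      by (intro add_mono) (simp_all add: j_def U2)
    also have "\<dots> \<le> (4 / 3 * B) * (4 / 3) ^ j"
      using B by (simp only: distrib_right[symmetric]) (intro mult_right_mono, auto)
    also have "\<dots> = B * ?w L U" by (simp add: j)
    finally show ?thesis .
  qed
qed

section \<open>The cost of a membership test and of a scan\<close>

lemma interval_bound_mono:
  assumes "interval_bound a B Q" "B \<le> B'"
  shows "interval_bound a B' Q"
  unfolding interval_bound_def
proof (intro allI impI)
  fix L U :: "'a set" assume "finite U" "a \<in> L"
  then have "real (card {S \<in> {L..U}. Q S}) \<le> B * (4 / 3) ^ card (U - L)"
    using assms(1) by (simp add: interval_bound_def)
  also have "\<dots> \<le> B' * (4 / 3) ^ card (U - L)"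
    using assms(2) by (intro mult_right_mono) auto
  finally show "real (card {S \<in> {L..U}. Q S}) \<le> B' * (4 / 3) ^ card (U - L)" .
qed

text \<open>The factor 3/2 solves B + B = 4/3 * (3/2 * B).\<close>

lemma interval_bound_member:
  assumes "\<And>b. interval_bound a B (Q b)" "0 \<le> B"
  shows "interval_bound a (3 / 2 * B) (\<lambda>S. Q (x \<in> S) S)"
  by (rule interval_bound_split[where ?B1.0 = B and ?B2.0 = B]) (use assms in auto)

text \<open>The factor 3 is a fixed point: at each list entry a hit ends the scan with bound
  \<open>B\<close>, a miss continues with \<open>3 * B\<close>, and B + 3 * B = 4/3 * (3 * B). Hence
  the cost of a scan does not grow with the length of the list.\<close>

lemma interval_bound_find:
  assumes "\<And>z. interval_bound a B (Q z)" "0 \<le> B"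
  shows "interval_bound a (3 * B) (\<lambda>S. Q (find (\<lambda>x. (x \<in> S) = b) xs) S)"
proof (induction xs)
  case Nil
  have "interval_bound a (3 * B) (Q None)"
    by (rule interval_bound_mono[of a B]) (use assms in auto)
  then show ?case by simp
next
  case (Cons x xs)
  let ?F = "\<lambda>S. find (\<lambda>x. (x \<in> S) = b) xs"
  \<comment> \<open>The test at the head becomes a Boolean argument, so that the splitting lemma
    applies with unequal bounds for hit and miss.\<close>
  let ?Q = "\<lambda>c S. if c = b then Q (Some x) S else Q (?F S) S"
  have "interval_bound a (3 * B) (\<lambda>S. ?Q (x \<in> S) S)"
  proof (cases b)
    case True
    show ?thesis
      by (rule interval_bound_split[of a B ?Q "3 * B"]) (use True Cons.IH assms in simp_all)
  next
    case False
    show ?thesis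
      by (rule interval_bound_split[of a "3 * B" ?Q B]) (use False Cons.IH assms in simp_all)
  qed
  moreover have "?Q (x \<in> S) S = Q (find (\<lambda>x. (x \<in> S) = b) (x # xs)) S" for S
    by simp
  ultimately show ?case by (simp only:)
qed

text \<open>For a clustering \<open>[S, X - S]\<close>, lying in cluster \<open>i\<close> amounts to
  \<open>(x \<in> S) = (i = 0)\<close> for points of \<open>X\<close>. Writing the least such point
  as a \<open>find\<close> makes a SEED answer a sequential scan of membership tests.\<close>

definition least_seed :: "'a::linorder seed_oracle" where
  "least_seed \<C> S i = find (\<lambda>x. (x \<in> \<C> ! 0) = (i = 0)) (sorted_list_of_set S)"

lemma valid_least_seed:
  assumes "finite X" "\<And>\<C>. \<C> \<in> \<S> \<Longrightarrow> \<exists>S. \<C> = [S, X - S]"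
  shows "valid_seed_oracle X \<S> least_seed"
  unfolding valid_seed_oracle_def
proof (intro ballI allI impI, elim conjE)
  fix \<C> T i assume "\<C> \<in> \<S>" "T \<subseteq> X" "i < length \<C>"
  moreover from this obtain S where "\<C> = [S, X - S]" using assms(2) by blast
  moreover have "finite T" using \<open>T \<subseteq> X\<close> assms(1) by (rule finite_subset)
  ultimately have "\<C> ! i \<inter> T = {x \<in> set (sorted_list_of_set T). (x \<in> \<C> ! 0) = (i = 0)}"
    by (auto simp: less_Suc_eq)
  then show "valid_seed_answer (\<C> ! i \<inter> T) (least_seed \<C> T i)"
    unfolding valid_seed_answer_def least_seed_def
    by (auto split: option.split simp: find_None_iff find_Some_iff)
qed

text \<open>Induction on the decision tree, with each query paying one factor 3. A SEED query is one
  scan; a same-cluster query is two membership tests, costing 9/4.\<close>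

lemma interval_bound_recovered:
  assumes "a \<in> X"
  shows "interval_bound a (3 ^ q) (\<lambda>S. alg_output least_seed [S, X - S] A = {S, X - S} \<and>
     alg_queries least_seed [S, X - S] A \<le> q)"
proof (induction A arbitrary: q)
  case (Output P)
  have "real (card {S \<in> {L..U}. P = {S, X - S}}) \<le> 3 ^ q * (4 / 3) ^ card (U - L)"
    if "finite U" "a \<in> L" for L U
  proof -
    have "finite {S \<in> {L..U}. P = {S, X - S}}"
      by (rule finite_subset[of _ "Pow U"]) (use that in auto)
    \<comment> \<open>An unordered output could also arise from the complementary cut, but
      \<open>a\<close> lies in both \<open>S\<close> and \<open>S'\<close>, which excludes S = X -
      S'. So a leaf recovers at most one set.\<close>
    moreover have "S = S'" if "S \<in> {L..U}" "S' \<in> {L..U}" "{S, X - S} = {S', X - S'}" for S S'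
      using that \<open>a \<in> L\<close> by (auto simp: doubleton_eq_iff)
    ultimately have "real (card {S \<in> {L..U}. P = {S, X - S}}) \<le> 1"
      by (auto simp: card_le_Suc0_iff_eq)
    also have "\<dots> \<le> 3 ^ q * (4 / 3) ^ card (U - L)"
      using mult_mono[of 1 "3 ^ q" 1 "(4 / 3 :: real) ^ card (U - L)"] by simp
    finally show ?thesis .
  qed
  then show ?case by (simp add: interval_bound_def)
next
  case (Same_Query x y f)
  show ?case
  proof (cases q)
    case 0
    then show ?thesis by (simp add: interval_bound_def)
  next
    case (Suc r)
    define Q where "Q b S \<longleftrightarrow> alg_output least_seed [S, X - S] (f b) = {S, X - S} \<and>
      alg_queries least_seed [S, X - S] (f b) \<le> r" for b S
    have "interval_bound a (3 ^ r) (Q b)" for b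
      using Same_Query[of "f b" r] by (simp add: Q_def[abs_def])
    \<comment> \<open>The test of \<open>y\<close> is charged first, with the outcome
      \<open>b\<close> of the test of \<open>x\<close> frozen; the next step charges the test of
      \<open>x\<close>. The formula spells out that both points lie in \<open>S\<close> or both in
      \<open>X - S\<close>.\<close>
    then have "interval_bound a (3 / 2 * 3 ^ r)
        (\<lambda>S. Q (b \<and> y \<in> S \<or> x \<in> X \<and> \<not> b \<and> y \<in> X \<and> y \<notin> S) S)" for b
      by (rule interval_bound_member[where
            Q = "\<lambda>c. Q (b \<and> c \<or> x \<in> X \<and> \<not> b \<and> y \<in> X \<and> \<not> c)"]) simp
    then have "interval_bound a (3 / 2 * (3 / 2 * 3 ^ r))
        (\<lambda>S. Q (x \<in> S \<and> y \<in> S \<or> x \<in> X \<and> x \<notin> S \<and> y \<in> X \<and> y \<notin> S) S)"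
      by (rule interval_bound_member[where
            Q = "\<lambda>b S. Q (b \<and> y \<in> S \<or> x \<in> X \<and> \<not> b \<and> y \<in> X \<and> y \<notin> S) S"]) simp
    then have "interval_bound a (3 ^ q)
        (\<lambda>S. Q (x \<in> S \<and> y \<in> S \<or> x \<in> X \<and> x \<notin> S \<and> y \<in> X \<and> y \<notin> S) S)"
      by (rule interval_bound_mono) (simp add: Suc)
    then show ?thesis by (simp add: Suc Q_def same_cluster_def)
  qed
next
  case (Seed_Query T i f)
  show ?case
  proof (cases q)
    case 0
    then show ?thesis by (simp add: interval_bound_def)
  next
    case (Suc r)
    define Q where "Q z S \<longleftrightarrow> alg_output least_seed [S, X - S] (f z) = {S, X - S} \<and>
      alg_queries least_seed [S, X - S] (f z) \<le> r" for z S
    have "interval_bound a (3 ^ r) (Q z)" for z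
      using Seed_Query[of "f z" r] by (simp add: Q_def[abs_def])
    from interval_bound_find[where Q = Q, OF this, of "i = 0" "sorted_list_of_set T"]
    have "interval_bound a (3 ^ q) (\<lambda>S. Q (least_seed [S, X - S] T i) S)"
      by (simp add: Suc least_seed_def)
    then show ?thesis by (simp add: Suc Q_def)
  qed
qed

section \<open>Success probability\<close>

text \<open>The averaging half of Yao's principle: a bound against every deterministic tree in the
  support of \<open>R\<close> carries over to the mixture.\<close>

lemma prob_pair_pmf_le:
  fixes b :: real
  assumes "\<And>y. y \<in> set_pmf R \<Longrightarrow> measure_pmf.prob D {x. (x, y) \<in> E} \<le> b" "0 \<le> b"
  shows "measure_pmf.prob (pair_pmf D R) E \<le> b"
proof -
  \<comment> \<open>By independence the tree can be drawn first and the hidden clustering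
    afterwards.\<close>
  have "pair_pmf D R = bind_pmf R (\<lambda>y. map_pmf (\<lambda>x. (x, y)) D)"
    unfolding pair_pmf_def map_pmf_def by (subst bind_commute_pmf) simp
  then have "emeasure (pair_pmf D R) E = (\<integral>\<^sup>+y. emeasure D {x. (x, y) \<in> E} \<partial>R)"
    by (simp add: vimage_def)
  also have "\<dots> \<le> (\<integral>\<^sup>+y. ennreal b \<partial>R)"
    using assms by (intro nn_integral_mono_AE)
      (auto simp: AE_measure_pmf_iff measure_pmf.emeasure_eq_measure intro: ennreal_leI)
  also have "\<dots> = ennreal b" by simp
  finally show ?thesis
    using assms(2) by (simp add: measure_pmf.emeasure_eq_measure)
qed

section \<open>Uniformly random cuts\<close>

lemma card_set_interval:
  assumes "finite U" "L \<subseteq> U"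
  shows "card {L..U} = 2 ^ card (U - L)"
proof -
  have "bij_betw (\<lambda>T. L \<union> T) (Pow (U - L)) {L..U}"
    by (rule bij_betw_byWitness[where f' = "\<lambda>S. S - L"]) (use assms in auto)
  then show ?thesis using assms by (metis bij_betw_same_card card_Pow finite_Diff)
qed

text \<open>\<open>L\<close> is forced into the first cluster and \<open>X - U\<close> into the
  second; the points of \<open>U - L\<close> are independent fair coin flips when
  \<open>L \<subseteq> U\<close> and \<open>U\<close> is finite.\<close>

definition random_cut :: "'a set \<Rightarrow> 'a set \<Rightarrow> 'a set \<Rightarrow> 'a set list pmf" where
  "random_cut X L U = map_pmf (\<lambda>S. [S, X - S]) (pmf_of_set {L..U})"

lemma set_pmf_random_cut:
  assumes "finite U" "L \<subseteq> U"
  shows "set_pmf (random_cut X L U) = (\<lambda>S. [S, X - S]) ` {L..U}"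
proof -
  have "finite {L..U}" by (rule finite_subset[of _ "Pow U"]) (use assms in auto)
  then show ?thesis using assms by (simp add: random_cut_def set_pmf_of_set)
qed

lemma prob_recovered_random_cut:
  assumes "a \<in> L" "L \<subseteq> U" "finite U" "a \<in> X"
  shows "measure_pmf.prob (random_cut X L U)
     {\<C>. alg_output least_seed \<C> A = set \<C> \<and> alg_queries least_seed \<C> A \<le> q}
     \<le> 3 ^ q * (2 / 3) ^ card (U - L)"
proof -
  let ?Q = "\<lambda>S. alg_output least_seed [S, X - S] A = {S, X - S} \<and>
     alg_queries least_seed [S, X - S] A \<le> q"
  have fin: "finite {L..U}" by (rule finite_subset[of _ "Pow U"]) (use assms in auto)
  have "measure_pmf.prob (random_cut X L U)
     {\<C>. alg_output least_seed \<C> A = set \<C> \<and> alg_queries least_seed \<C> A \<le> q}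
     = real (card {S \<in> {L..U}. ?Q S}) / real (card {L..U})"
    using fin assms by (simp add: random_cut_def measure_pmf_of_set vimage_def Int_def)
  also have "\<dots> \<le> 3 ^ q * (4 / 3) ^ card (U - L) / 2 ^ card (U - L)"
    using interval_bound_recovered[OF assms(4), of q A] assms
    by (simp add: card_set_interval interval_bound_def divide_right_mono)
  also have "\<dots> = 3 ^ q * (2 / 3) ^ card (U - L)"
    by (simp add: power_divide[symmetric] flip: times_divide_eq_right)
  finally show ?thesis .
qed

text \<open>Recovery must succeed against every valid SEED oracle, so it may be tested against
  \<open>least_seed\<close> alone.\<close>

lemma recovers_random_cut_le:
  fixes X :: "'a::linorder set"
  assumes "a \<in> L" "L \<subseteq> U" "U \<subseteq> X" "finite X"
    and "recovers_with_prob X (random_cut X L U) R q p"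
  shows "p \<le> 3 ^ q * (2 / 3) ^ card (U - L)"
proof -
  have fin: "finite U" using assms(3,4) by (rule finite_subset)
  have "valid_seed_oracle X (set_pmf (random_cut X L U)) least_seed"
    using assms fin by (intro valid_least_seed) (auto simp: set_pmf_random_cut)
  then have "p \<le> measure_pmf.prob (pair_pmf (random_cut X L U) R)
      {(\<C>, A). alg_output least_seed \<C> A = set \<C> \<and> alg_queries least_seed \<C> A \<le> q}"
    using assms(5) by (simp add: recovers_with_prob_def)
  also have "\<dots> \<le> 3 ^ q * (2 / 3) ^ card (U - L)"
    using prob_recovered_random_cut[of a L U X] assms fin by (intro prob_pair_pmf_le) auto
  finally show ?thesis .
qed

text \<open>The constant 1/4 works because 3 * (2/3)^4 = 48/81 < 1: if q < (m + 4)/4, the fourth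
  power of the success bound is at most 81 * (48/81)^m, which tends to 0. How large m must be
  depends on \<open>p\<close> only, not on \<open>q\<close>. The shift by 4 matches the size of the
  space used below.\<close>

lemma eventually_quarter_le_queries:
  fixes p :: real
  assumes "0 < p"
  shows "\<forall>\<^sub>F m in sequentially. \<forall>q. p \<le> 3 ^ q * (2 / 3) ^ m \<longrightarrow> 1 / 4 * real (m + 4) \<le> real q"
proof -
  have "(\<lambda>m. 81 * (48 / 81 :: real) ^ m) \<longlonglongrightarrow> 81 * 0"
    by (intro tendsto_mult_left LIMSEQ_realpow_zero) auto
  moreover have "0 < p ^ 4" using assms by simp
  ultimately have "\<forall>\<^sub>F m in sequentially. 81 * (48 / 81 :: real) ^ m < p ^ 4"
    by (intro order_tendstoD(2)[of _ "81 * 0"]) simp_all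
  then show ?thesis
  proof eventually_elim
    case (elim m)
    show ?case
    proof (intro allI impI, rule ccontr)
      fix q assume p: "p \<le> 3 ^ q * (2 / 3) ^ m" and "\<not> 1 / 4 * real (m + 4) \<le> real q"
      then have q: "q * 4 \<le> m + 4" by simp
      have "p ^ 4 \<le> (3 ^ q * (2 / 3) ^ m) ^ 4" using p assms by (intro power_mono) auto
      also have "\<dots> = 3 ^ (q * 4) * ((2 / 3) ^ 4) ^ m"
        by (simp only: power_mult_distrib power_mult[symmetric] mult.commute[of m 4])
      also have "\<dots> \<le> 3 ^ (m + 4) * ((2 / 3) ^ 4) ^ m"
        using q by (intro mult_right_mono power_increasing) auto
      also have "\<dots> = 81 * (3 * (2 / 3) ^ 4) ^ m"
        by (simp only: power_add power_mult_distrib) simp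
      also have "\<dots> = 81 * (48 / 81) ^ m" by (simp add: power_divide)
      finally show False using elim by simp
    qed
  qed
qed

theorem theorem14:
  shows "\<exists>c::real. 0 < c \<and>
    (\<forall>\<beta> \<gamma> :: real. 0 < \<beta> \<and> \<beta> < 1 \<and> 0 < \<gamma> \<and> \<gamma> < 1 \<longrightarrow>
      (\<exists>(X :: nat \<Rightarrow> nat set) (d :: nat \<Rightarrow> nat \<Rightarrow> nat \<Rightarrow> ereal) (\<epsilon> :: nat \<Rightarrow> real)
         (D :: nat \<Rightarrow> nat set list pmf).
        (\<forall>m. finite_semimetric (X m) (d m) \<and>
             real (card (X m)) = 2 powr dens (X m) (d m) \<and>
             (\<forall>\<C>\<in>set_pmf (D m).
                clustering (X m) 2 \<C> \<and>
                uniform_convex (X m) (d m) \<beta> \<gamma> \<C> \<and>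
                uniform_radius (X m) (d m) \<beta> \<gamma> \<C> (\<epsilon> m) \<and>
                generalized_convex (X m) (d m) \<beta> \<gamma> \<C> \<and>
                (\<forall>C\<in>set \<C>. generalized_radius (X m) (d m) \<beta> \<gamma> C (\<epsilon> m)))) \<and>
        filterlim (\<lambda>m. card (X m)) at_top sequentially \<and>
        (\<forall>p>0. \<forall>\<^sub>F m in sequentially. \<forall>(R :: nat query_alg pmf) (q :: nat).
           (\<forall>A\<in>set_pmf R. legal_alg (X m) 2 A) \<longrightarrow>
           recovers_with_prob (X m) (D m) R q p \<longrightarrow>
           c * 2 powr dens (X m) (d m) \<le> real q)))"
proof (intro exI[of _ "1 / 4"] conjI allI impI)
  fix \<beta> \<gamma> :: real
  assume *: "0 < \<beta> \<and> \<beta> < 1 \<and> 0 < \<gamma> \<and> \<gamma> < 1"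
  define X :: "nat \<Rightarrow> nat set" where "X m = {..<m + 4}" for m
  \<comment> \<open>Fixing 0, 1 on one side and 2, 3 on the other rules out singleton clusters,
    which are connected at every positive threshold and so have no smallest generalized radius. It
    also supplies the known point 0 and leaves m of the m + 4 points undetermined.\<close>
  define L :: "nat set" where "L = {0, 1}"
  define U :: "nat \<Rightarrow> nat set" where "U m = X m - {2, 3}" for m
  have finX: "finite (X m)" and cardX: "card (X m) = m + 4" for m by (simp_all add: X_def)
  have LU: "L \<subseteq> U m" "U m \<subseteq> X m" and finU: "finite (U m)" for m
    by (auto simp: L_def U_def X_def)
  have "U m - L = {4..<m + 4}" for m by (auto simp: L_def U_def X_def)
  then have cardUL: "card (U m - L) = m" for m by simp
  have dens: "2 powr dens (X m) discrete_dist = real (m + 4)" for m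
  proof -
    have "0 \<in> X m" by (simp add: X_def)
    then have "X m \<noteq> {}" by blast
    then show ?thesis by (simp add: dens_def density_constant_discrete finX cardX)
  qed
  \<comment> \<open>The radius is 1 for every clustering in the support, so knowing \<beta>,
    \<gamma> and the radius reveals nothing about the cut.\<close>
  have convex: "clustering (X m) 2 \<C> \<and>
      uniform_convex (X m) discrete_dist \<beta> \<gamma> \<C> \<and>
      uniform_radius (X m) discrete_dist \<beta> \<gamma> \<C> 1 \<and>
      generalized_convex (X m) discrete_dist \<beta> \<gamma> \<C> \<and>
      (\<forall>C\<in>set \<C>. generalized_radius (X m) discrete_dist \<beta> \<gamma> C 1)"
    if cut: "\<C> \<in> set_pmf (random_cut (X m) L (U m))" for m \<C>
  proof -
    obtain S where \<C>: "\<C> = [S, X m - S]" and "S \<in> {L..U m}"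
      using cut unfolding set_pmf_random_cut[OF finU LU(1)] by blast
    then have S: "L \<subseteq> S" "S \<subseteq> U m" by simp_all
    have in_S: "0 \<in> S" "1 \<in> S" using S(1) by (auto simp: L_def)
    have notin_S: "2 \<in> X m - S" "3 \<in> X m - S" using S(2) by (auto simp: U_def X_def)
    have "S \<subseteq> X m" using S(2) LU by blast
    have C: "C \<subseteq> X m \<and> (\<exists>x\<in>C. \<exists>y\<in>C. x \<noteq> y)" if "C \<in> set \<C>" for C
    proof -
      have "\<exists>x\<in>S. \<exists>y\<in>S. x \<noteq> y" using in_S by (metis zero_neq_one)
      moreover have "\<exists>x\<in>X m - S. \<exists>y\<in>X m - S. x \<noteq> y"
        using notin_S by (intro bexI[of _ 2] bexI[of _ 3]) auto
      ultimately show ?thesis using that \<open>S \<subseteq> X m\<close> by (auto simp: \<C>)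
    qed
    have "clustering (X m) 2 \<C>"
      using in_S notin_S \<open>S \<subseteq> X m\<close>
      by (auto simp: clustering_def \<C> partition_on_def disjoint_def)
    moreover have unif: "uniform_radius (X m) discrete_dist \<beta> \<gamma> \<C> 1"
      using * C by (intro uniform_radius_discrete) (auto simp: \<C>)
    moreover have gen: "\<forall>C\<in>set \<C>. generalized_radius (X m) discrete_dist \<beta> \<gamma> C 1"
    proof
      fix C assume "C \<in> set \<C>"
      with C obtain x y where "x \<in> C" "y \<in> C" "x \<noteq> y" "C \<subseteq> X m" by blast
      then show "generalized_radius (X m) discrete_dist \<beta> \<gamma> C 1"
        using * by (intro generalized_radius_discrete) auto
    qed
    ultimately show ?thesis
      by (auto simp: uniform_convex_def uniform_radius_def generalized_convex_def
          generalized_radius_def)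
  qed
  \<comment> \<open>The threshold on \<open>m\<close> is fixed before \<open>R\<close> and
    \<open>q\<close>, so the bound is uniform over all algorithms.\<close>
  have lower: "\<forall>\<^sub>F m in sequentially. \<forall>(R :: nat query_alg pmf) (q :: nat).
      (\<forall>A\<in>set_pmf R. legal_alg (X m) 2 A) \<longrightarrow>
      recovers_with_prob (X m) (random_cut (X m) L (U m)) R q p \<longrightarrow>
      1 / 4 * 2 powr dens (X m) discrete_dist \<le> real q" if "0 < p" for p
    using eventually_quarter_le_queries[OF that]
  proof eventually_elim
    case (elim m)
    show ?case
    proof (intro allI impI)
      fix R q
      assume "recovers_with_prob (X m) (random_cut (X m) L (U m)) R q p"
      then have "p \<le> 3 ^ q * (2 / 3) ^ card (U m - L)"
        using LU finX by (intro recovers_random_cut_le[of 0]) (auto simp: L_def)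
      then show "1 / 4 * 2 powr dens (X m) discrete_dist \<le> real q"
        using elim by (simp only: dens cardUL)
    qed
  qed
  have unbounded: "filterlim (\<lambda>m. card (X m)) at_top sequentially"
    unfolding cardX by (rule filterlim_add_const_nat_at_top)
  show "\<exists>(X :: nat \<Rightarrow> nat set) (d :: nat \<Rightarrow> nat \<Rightarrow> nat \<Rightarrow> ereal) (\<epsilon> :: nat \<Rightarrow> real)
         (D :: nat \<Rightarrow> nat set list pmf).
        (\<forall>m. finite_semimetric (X m) (d m) \<and>
             real (card (X m)) = 2 powr dens (X m) (d m) \<and>
             (\<forall>\<C>\<in>set_pmf (D m).
                clustering (X m) 2 \<C> \<and>
                uniform_convex (X m) (d m) \<beta> \<gamma> \<C> \<and>
                uniform_radius (X m) (d m) \<beta> \<gamma> \<C> (\<epsilon> m) \<and>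
                generalized_convex (X m) (d m) \<beta> \<gamma> \<C> \<and>
                (\<forall>C\<in>set \<C>. generalized_radius (X m) (d m) \<beta> \<gamma> C (\<epsilon> m)))) \<and>
        filterlim (\<lambda>m. card (X m)) at_top sequentially \<and>
        (\<forall>p>0. \<forall>\<^sub>F m in sequentially. \<forall>(R :: nat query_alg pmf) (q :: nat).
           (\<forall>A\<in>set_pmf R. legal_alg (X m) 2 A) \<longrightarrow>
           recovers_with_prob (X m) (D m) R q p \<longrightarrow>
           1 / 4 * 2 powr dens (X m) (d m) \<le> real q)"
    by (rule exI[of _ X], rule exI[of _ "\<lambda>_. discrete_dist"], rule exI[of _ "\<lambda>_. 1"],
        rule exI[of _ "\<lambda>m. random_cut (X m) L (U m)"], intro conjI)
      (use finite_semimetric_discrete[OF finX] convex in \<open>simp add: dens cardX\<close>,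
       rule unbounded, use lower in blast)
qed simp

end
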